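(* Let $(X,d)$ be a compact metric space, let $n\ge 1$, let $f_1,\dots,f_n:X\to X$ be continuous surjective maps, and let $(X,\mathbb{F})$ be the non-autonomous dynamical system generated by the finite family $\mathbb{F}=\{f_1,\dots,f_n\}$. If the autonomous system $(X,\,f_n\circ f_{n-1}\circ\cdots\circ f_1)$ is Li-Yorke chaotic, then $(X,\mathbb{F})$ is Li-Yorke chaotic.
   Context: The non-autonomous system generated by the finite ordered family $\mathbb{F}=\{f_1,\dots,f_n\}$ is obtained by repeating the maps cyclically: for every $k\ge1$ put $f_k=f_{1+((k-1)\bmod n)}$, and let $\omega_k=f_k\circ f_{k-1}\circ\cdots\circ f_1$. A set $S\subseteq X$ is scrambled for $(X,\mathbb{F})$ if for any distinct $x,y\in S$, $\limsup_{k\to\infty}d(\omega_k(x),\omega_k(y))>0$ and $\liminf_{k\to\infty}d(\omega_k(x),\omega_k(y))=0$. The system $(X,\mathbb{F})$ is Li-Yorke chaotic if it contains an uncountable scrambled set. For an autonomous system $(X,g)$ the same definitions apply with $\omega_k=g^k$. *)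

theory Defs
  imports "HOL-Analysis.Analysis"
begin

text \<open>Sequences of maps are indexed from 1: the orbit map at time \<open>k\<close> is
  \<open>g k \<circ> g (k - 1) \<circ> \<dots> \<circ> g 1\<close>, and \<open>g 0\<close> is never used.\<close>

primrec orbit_map :: "(nat \<Rightarrow> 'a \<Rightarrow> 'a) \<Rightarrow> nat \<Rightarrow> 'a \<Rightarrow> 'a" where
  "orbit_map g 0 = id"
| "orbit_map g (Suc k) = g (Suc k) \<circ> orbit_map g k"

text \<open>Only the values of \<open>f\<close> at \<open>1, \<dots>, n\<close> matter; time \<open>k \<ge> 1\<close> is the intended range.\<close>

definition cyclic_family :: "nat \<Rightarrow> (nat \<Rightarrow> 'a \<Rightarrow> 'a) \<Rightarrow> nat \<Rightarrow> 'a \<Rightarrow> 'a" where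
  "cyclic_family n f k = f (1 + (k - 1) mod n)"

text \<open>In the following definitions \<open>w k\<close> is the state map at time \<open>k\<close>: \<open>w = orbit_map g\<close> for a
  non-autonomous system, and \<open>w k = g ^^ k\<close> for an autonomous one. The cast to \<^typ>\<open>ereal\<close>
  is there because \<^const>\<open>limsup\<close> and \<^const>\<open>liminf\<close> need a complete lattice.\<close>

definition scrambled :: "'a::metric_space set \<Rightarrow> (nat \<Rightarrow> 'a \<Rightarrow> 'a) \<Rightarrow> 'a set \<Rightarrow> bool" where
  "scrambled X w S \<longleftrightarrow> S \<subseteq> X \<and>
     (\<forall>x\<in>S. \<forall>y\<in>S. x \<noteq> y \<longrightarrow>
        limsup (\<lambda>k. ereal (dist (w k x) (w k y))) > 0 \<and>
        liminf (\<lambda>k. ereal (dist (w k x) (w k y))) = 0)"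

definition li_yorke_chaotic :: "'a::metric_space set \<Rightarrow> (nat \<Rightarrow> 'a \<Rightarrow> 'a) \<Rightarrow> bool" where
  "li_yorke_chaotic X w \<longleftrightarrow> (\<exists>S. scrambled X w S \<and> uncountable S)"

definition autonomous_chaotic :: "'a::metric_space set \<Rightarrow> ('a \<Rightarrow> 'a) \<Rightarrow> bool" where
  "autonomous_chaotic X g \<longleftrightarrow> li_yorke_chaotic X (\<lambda>k. g ^^ k)"

definition family_chaotic :: "'a::metric_space set \<Rightarrow> nat \<Rightarrow> (nat \<Rightarrow> 'a \<Rightarrow> 'a) \<Rightarrow> bool" where
  "family_chaotic X n f \<longleftrightarrow> li_yorke_chaotic X (orbit_map (cyclic_family n f))"

end

theory Submission
  imports Defs
begin

text \<open>At the multiples of \<open>n\<close> the orbit of the cyclic family is the orbit of the composite map, so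
  the distances along the autonomous orbits form a subsequence of those along the non-autonomous
  ones. Passing to the full sequence can only raise the limsup and lower the liminf, and the liminf
  stays nonnegative; hence the same scrambled set works.\<close>

text \<open>For \<open>j < n\<close> the map applied at time \<open>m * n + j + 1\<close> has index
  \<open>1 + (m * n + j) mod n = j + 1\<close>, so each block of length \<open>n\<close> starts
  afresh with \<open>f 1\<close>. The bound includes \<open>j = n\<close> so that a whole period is
  covered.\<close>

lemma orbit_map_cyclic_add:
  assumes "j \<le> n"
  shows "orbit_map (cyclic_family n f) (m * n + j)
    = orbit_map f j \<circ> orbit_map (cyclic_family n f) (m * n)"
  using assms
  by (induction j) (auto simp: cyclic_family_def comp_assoc)

lemma orbit_map_cyclic_mult:
  "orbit_map (cyclic_family n f) (m * n) = orbit_map f n ^^ m"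
proof (induction m)
  case (Suc m)
  \<comment> \<open>The instance \<open>j = n\<close> contributes one more factor
    \<open>orbit_map f n\<close> on the left.\<close>
  then show ?case
    using orbit_map_cyclic_add[of n n f m] by (simp add: add.commute)
qed simp

lemma scrambled_of_subseq:
  assumes "scrambled X (w \<circ> r) S" and "strict_mono r"
  shows "scrambled X w S"
  unfolding scrambled_def
proof (intro conjI ballI impI)
  show "S \<subseteq> X"
    using assms(1) by (simp add: scrambled_def)
next
  fix x y assume xy: "x \<in> S" "y \<in> S" "x \<noteq> y"
  let ?D = "\<lambda>k. ereal (dist (w k x) (w k y))"
  have "0 < limsup (?D \<circ> r)"
    using assms(1) xy by (simp add: scrambled_def comp_def)
  then show "0 < limsup ?D"
    using limsup_subseq_mono[OF assms(2), of ?D] by simp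
  have "liminf (?D \<circ> r) = 0"
    using assms(1) xy by (simp add: scrambled_def comp_def)
  then have "liminf ?D \<le> 0"
    using liminf_subseq_mono[OF assms(2), of ?D] by simp
  moreover have "0 \<le> liminf ?D"
    by (intro Liminf_bounded) simp
  ultimately show "liminf ?D = 0"
    by simp
qed

theorem lemma16:
  fixes X :: "'a::metric_space set" and n :: nat and f :: "nat \<Rightarrow> 'a \<Rightarrow> 'a"
  assumes "compact X"
    and "n \<ge> 1"
    and "\<And>i. i \<in> {1..n} \<Longrightarrow> continuous_on X (f i)"
    and "\<And>i. i \<in> {1..n} \<Longrightarrow> f i ` X = X"
    and "autonomous_chaotic X (orbit_map f n)"
  shows "family_chaotic X n f"
proof -
  obtain S where S: "scrambled X (\<lambda>k. orbit_map f n ^^ k) S" "uncountable S"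
    using assms(5) by (auto simp: autonomous_chaotic_def li_yorke_chaotic_def)
  have "scrambled X (orbit_map (cyclic_family n f) \<circ> (\<lambda>m. m * n)) S"
    using S(1) by (simp add: comp_def orbit_map_cyclic_mult)
  \<comment> \<open>Here \<open>n \<ge> 1\<close> matters: for \<open>n = 0\<close> the sampling
    times would all be \<open>0\<close>.\<close>
  moreover have "strict_mono (\<lambda>m. m * n)"
    using assms(2) by (simp add: strict_mono_def)
  ultimately have "scrambled X (orbit_map (cyclic_family n f)) S"
    by (rule scrambled_of_subseq)
  with S(2) show ?thesis
    by (auto simp: family_chaotic_def li_yorke_chaotic_def)
qed

end
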